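(* Let $K$ be a field and let $A=\{x_i\mid i\in I\}$ be a well-ordered set, where $I$ is ordered so that $x_i>x_j$ if and only if $i>j$. Let $S\subseteq K\langle A\rangle$ be the set consisting of the polynomials $x_ix_jx_k-x_jx_ix_k$, $x_ix_kx_j-x_jx_ix_k$ and $x_ix_jx_ix_k-x_ix_kx_ix_j$ for all $i>j>k$ in $I$, and $x_ix_jx_j-x_jx_ix_j$ and $x_ix_ix_j-x_ix_jx_i$ for all $i>j$ in $I$. Let $\Omega\subseteq A^*$ and the insertion operation $\star$ be as defined in the context. Let $u_n=w_1w_2\cdots w_n\in\Omega$ and $x\in A$. Then $u_n\star x\in\Omega$, and in $K\langle A\mid S\rangle$ one has $u_nx=u_n\star x$.
   Context: $A^*$ is the free monoid on $A$ (empty word $=1$), $K\langle A\rangle$ is the free associative algebra over $K$ generated by $A$, and $K\langle A\mid S\rangle=K\langle A\rangle/\mathrm{Id}(S)$, where $\mathrm{Id}(S)$ is the two-sided ideal generated by $S$. Equality of words in $K\langle A\mid S\rangle$ means equality of their images. $\Omega$ is the set of all words on $A$ of the form $u_n=w_1w_2\cdots w_n$, $n\ge 0$ ($u_0$ is the empty word), where $x_1<x_2<\cdots<x_n$ are elements of $A$ (here $x_1,\dots,x_n$ is a local naming of an arbitrary finite increasing sequence in $A$), $w_1=x_1^{t_{1,1}}$, and for $2\le k\le n$ $$w_k=\Big(\prod_{1\le i\le k-1}(x_kx_i)^{t_{k,i}}\Big)x_k^{t_{k,k}}=(x_kx_1)^{t_{k,1}}(x_kx_2)^{t_{k,2}}\cdots(x_kx_{k-1})^{t_{k,k-1}}x_k^{t_{k,k}},$$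 with all exponents $t_{k,i}$ non-negative integers (zero exponents are allowed, so a word comes with a chosen sequence $x_1<\dots<x_n$ and exponents). Insertion operation. For $u_n=w_1\cdots w_n\in\Omega$ (with its data $x_1<\cdots<x_n$, $t_{k,i}$), write $u_{n-1}=w_1\cdots w_{n-1}$ and $N(w_n)=\{i\mid t_{n,i}\ne 0\}\subseteq\{1,\dots,n\}$. The notation $w_n|_{t_{n,i}\to t'}$ means $w_n$ with the exponent $t_{n,i}$ replaced by $t'$. For $x\in A$ define $u_n\star x$ by induction on $n$, as follows; for $n=0$, $u_0\star x=x$ (this is case (1)). \begin{enumerate} \item[(1)] If $x>x_n$, then $u_n\star x=u_nw_{n+1}$, where $w_{n+1}=x$ (with $x_{n+1}=x$). \item[(2)] If $x=x_n$, then $u_n\star x=u_{n-1}w_n'$, where $w_n'=w_n|_{t_{n,n}\to t_{n,n}+1}$. \item[(3)] If $x_1\le x=x_k<x_n$, let $i$ be the greatest element of $N(w_n)$, with $i=k$ if $N(w_n)=\varnothing$. \begin{enumerate} \item[(a)] If $x\ge x_i$, then $u_n\star x=(u_{n-1}\star x)w_n$. \item[(b)] If $x<x_i<x_n$, then $u_n\star x=(u_{n-1}\star x_i)w_n'$, where $w_n'=w_n|_{t_{n,i}\to t_{n,i}-1,\ t_{n,k}\to t_{n,k}+1}$. \item[(c)] If $x<x_i=x_n$, then $u_n\star x=u_{n-1}w_n'$, where $w_n'=w_n|_{t_{n,n}\to t_{n,n}-1,\ t_{n,k}\to t_{n,k}+1}$. \end{enumerate} If $x_1<x<x_n$ and $x\notin\{x_1,\dots,x_n\}$,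 first insert $x$ into the sequence $x_1<\cdots<x_n$, relabel, and set all exponents involving the new letter equal to $0$ (this does not change the word); then apply (3). \item[(4)] If $x<x_1$, then $u_n\star x=u_{n+1}\star x$, where $x_0=x$, $w_0=x_0^0$ and $u_{n+1}=w_0u_n$; that is, $x$ is added to the sequence as a new smallest letter with all exponents involving it equal to $0$, the sequence is relabelled, and case (3) is applied. \end{enumerate} *)

theory Defs
  imports "HOL-Algebra.Algebraic_Closure_Type" "HOL-Library.Poly_Mapping"
begin

section \<open>The free algebra and algebras given by generators and relations\<close>

text \<open>
  The free monoid on a type of letters is the type of lists under concatenation. Written additively,
  as the type class hierarchy requires, it makes the type of finitely supported functions from
  words to \<open>'k\<close>, with the convolution product, the free associative algebra over \<open>'k\<close>.
\<close>

instantiation list :: (type) monoid_add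
begin

definition zero_list :: "'a list" where "zero_list = []"

definition plus_list :: "'a list \<Rightarrow> 'a list \<Rightarrow> 'a list" where "plus_list u v = u @ v"

instance by standard (simp_all add: zero_list_def plus_list_def)

end

type_synonym ('a, 'k) free_algebra = "'a list \<Rightarrow>\<^sub>0 'k"

definition word_monom :: "'a list \<Rightarrow> ('a, 'k::field) free_algebra" where
  "word_monom w = Poly_Mapping.single w 1"

abbreviation letter :: "'a \<Rightarrow> ('a, 'k::field) free_algebra" where
  "letter a \<equiv> word_monom [a]"

lemma word_monom_mult: "word_monom u * word_monom v = word_monom (u @ v)"
  by (simp add: word_monom_def mult_single plus_list_def)

abbreviation free_ring :: "('a, 'k::field) free_algebra ring" where
  "free_ring \<equiv> ring_of_type_algebra"

text \<open>
  \<open>Idl\<close> is the two-sided ideal generated by a set. Since the free algebra is unital and its scalars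
  are central, ring ideals and algebra ideals coincide.
\<close>

definition presented_algebra ::
  "('a, 'k::field) free_algebra set \<Rightarrow> ('a, 'k) free_algebra set ring" where
  "presented_algebra S = free_ring Quot (Idl\<^bsub>free_ring\<^esub> S)"

definition word_image ::
  "('a, 'k::field) free_algebra set \<Rightarrow> 'a list \<Rightarrow> ('a, 'k) free_algebra set" where
  "word_image S w = (Idl\<^bsub>free_ring\<^esub> S) +>\<^bsub>free_ring\<^esub> word_monom w"

lemma ring_free_ring: "ring (free_ring :: ('a, 'k::field) free_algebra ring)"
proof -
  have "\<exists>y. x + y = 0" for x :: "('a, 'k) free_algebra"
    using add.right_inverse by blast
  then show ?thesis
    unfolding ring_of_type_algebra_def using add.right_inverse
    by unfold_locales (auto simp: algebra_simps Units_def)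
qed

lemma ideal_Idl_free_ring:
  fixes S :: "('a, 'k::field) free_algebra set"
  shows "ideal (Idl\<^bsub>free_ring\<^esub> S) (free_ring :: ('a, 'k) free_algebra ring)"
  by (rule ring.genideal_ideal[OF ring_free_ring])
     (simp add: ring_of_type_algebra_def)

lemma ring_presented_algebra: "ring (presented_algebra S)"
  unfolding presented_algebra_def by (rule ideal.quotient_is_ring[OF ideal_Idl_free_ring])

lemma word_image_append:
  "word_image S (u @ v) = word_image S u \<otimes>\<^bsub>presented_algebra S\<^esub> word_image S v"
  using ring_hom_mult[OF ideal.rcos_ring_hom[OF ideal_Idl_free_ring[of S]],
      of "word_monom u" "word_monom v"]
  by (simp add: word_image_def presented_algebra_def ring_of_type_algebra_def word_monom_mult)


section \<open>The relations\<close>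

text \<open>The letter \<open>x\<^sub>i\<close> is identified with its index \<open>i\<close>, so that \<open>A\<close> is the type \<open>'a\<close>.\<close>

definition relations :: "('a::wellorder, 'k::field) free_algebra set" where
  "relations =
     {letter i * letter j * letter k - letter j * letter i * letter k | i j k. i > j \<and> j > k} \<union>
     {letter i * letter k * letter j - letter j * letter i * letter k | i j k. i > j \<and> j > k} \<union>
     {letter i * letter j * letter i * letter k - letter i * letter k * letter i * letter j
        | i j k. i > j \<and> j > k} \<union>
     {letter i * letter j * letter j - letter j * letter i * letter j | i j. i > j} \<union>
     {letter i * letter i * letter j - letter i * letter j * letter i | i j. i > j}"


section \<open>The words in \<open>\<Omega>\<close>\<close>

text \<open>
  The data of a word \<open>u\<^sub>n\<close> are the list \<open>xs = [x\<^sub>1, \<dots>, x\<^sub>n]\<close> and the exponents, indexed by letters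
  instead of positions: \<open>t\<^sub>k\<^sub>,\<^sub>i\<close> is \<open>t x\<^sub>k x\<^sub>i\<close>. The values of \<open>t\<close> at pairs other than \<open>(x\<^sub>k, x\<^sub>i)\<close> with
  \<open>i \<le> k\<close> are irrelevant, and no relabelling is needed when a letter is inserted.
\<close>

definition word_power :: "'a list \<Rightarrow> nat \<Rightarrow> 'a list" where
  "word_power w m = concat (replicate m w)"

text \<open>The factor \<open>w\<^sub>k\<close>, for \<open>ys = [x\<^sub>1, \<dots>, x\<^sub>k\<^sub>-\<^sub>1]\<close> and \<open>y = x\<^sub>k\<close>.\<close>

definition factor :: "('a \<Rightarrow> 'a \<Rightarrow> nat) \<Rightarrow> 'a list \<Rightarrow> 'a \<Rightarrow> 'a list" where
  "factor t ys y = concat (map (\<lambda>z. word_power [y, z] (t y z)) ys) @ word_power [y] (t y y)"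

definition omega_word :: "'a list \<Rightarrow> ('a \<Rightarrow> 'a \<Rightarrow> nat) \<Rightarrow> 'a list" where
  "omega_word xs t = concat (map (\<lambda>k. factor t (take k xs) (xs ! k)) [0..<length xs])"

definition Omega :: "'a::wellorder list set" where
  "Omega = {omega_word xs t | xs t. sorted_wrt (<) xs}"


section \<open>The insertion operation\<close>

definition add_letter :: "'a \<Rightarrow> ('a \<Rightarrow> 'a \<Rightarrow> nat) \<Rightarrow> 'a \<Rightarrow> 'a \<Rightarrow> nat" where
  "add_letter x t = (\<lambda>y z. if y = x \<or> z = x then 0 else t y z)"

text \<open>
  The letter \<open>x\<^sub>i\<close> of case (3), for \<open>y = x\<^sub>n\<close>: the greatest \<open>x\<^sub>i\<close> with \<open>t\<^sub>n\<^sub>,\<^sub>i \<noteq> 0\<close>, and \<open>x\<close> itself if there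
  is none.
\<close>

definition top_letter :: "'a::wellorder list \<Rightarrow> ('a \<Rightarrow> 'a \<Rightarrow> nat) \<Rightarrow> 'a \<Rightarrow> 'a \<Rightarrow> 'a" where
  "top_letter xs t y x =
     (let N = {z \<in> set xs. t y z \<noteq> 0} in if N = {} then x else Max N)"

text \<open>
  \<open>star xs t x\<close> is the word \<open>u\<^sub>n \<star> x\<close>, for the word \<open>u\<^sub>n\<close> with data \<open>xs\<close> and \<open>t\<close>. In the equation, \<open>y\<close> is
  \<open>x\<^sub>n\<close> and \<open>i\<close> is the letter \<open>x\<^sub>i\<close> of case (3). The branches with \<open>i\<close> are, in this order, cases (a), (b)
  and (c). The last branch covers both an \<open>x\<close> strictly between \<open>x\<^sub>1\<close> and \<open>x\<^sub>n\<close> that does not occur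
  in \<open>xs\<close>, and case (4).

  The recursion terminates because adding \<open>x\<close> to \<open>xs\<close> happens at most once: all letters inserted later
  occur in the list.
\<close>

function star :: "'a::wellorder list \<Rightarrow> ('a \<Rightarrow> 'a \<Rightarrow> nat) \<Rightarrow> 'a \<Rightarrow> 'a list" where
  "star xs t x =
     (if xs = [] then [x]
      else let y = last xs; ys = butlast xs; i = top_letter xs t y x in
        if x > y then omega_word xs t @ [x]
        else if x = y then
          omega_word ys t @ factor (t(y := (t y)(y := t y y + 1))) ys y
        else if x \<in> set xs then
          (if x \<ge> i then star ys t x @ factor t ys y
           else if i < y then
             star ys t i @ factor (t(y := (t y)(i := t y i - 1, x := t y x + 1))) ys y
           else
             omega_word ys t @ factor (t(y := (t y)(y := t y y - 1, x := t y x + 1))) ys y)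
        else star (insort x xs) (add_letter x t) x)"
  by pat_completeness auto

lemma top_letter_cases: "top_letter xs t y x = x \<or> top_letter xs t y x \<in> set xs"
proof -
  define N where "N = {z \<in> set xs. t y z \<noteq> 0}"
  have "finite N" "N \<subseteq> set xs" by (auto simp: N_def)
  then have "N \<noteq> {} \<Longrightarrow> Max N \<in> set xs" using Max_in[of N] by blast
  then show ?thesis by (auto simp: top_letter_def N_def Let_def)
qed

lemma in_set_butlast_if_not_last: "z \<in> set xs \<Longrightarrow> z \<noteq> last xs \<Longrightarrow> z \<in> set (butlast xs)"
  by (induction xs) auto

termination star
proof (relation "inv_image (less_than <*lex*> less_than)
                   (\<lambda>(xs, t, x). (if x \<in> set xs then 0 else 1, length xs))", goal_cases)
  case 1
  show ?case by auto
next
  case (2 xs t x y ys i)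
  then show ?case by (auto dest: in_set_butlast_if_not_last)
next
  case (3 xs t x y ys i)
  then have "i \<in> set xs" using top_letter_cases[of xs t y x] by auto
  with 3 show ?case by (auto dest: in_set_butlast_if_not_last)
next
  case (4 xs t x y ys i)
  then show ?case by (auto simp: set_insort_key)
qed

declare star.simps [simp del]

end

theory Submission
  imports Defs
begin

text \<open>
  Modulo the relations, \<open>y z y x = y x y z\<close> for \<open>x, z < y\<close> and \<open>y z x = x y z\<close> for \<open>z \<le> x < y\<close>, so
  the blocks \<open>y z\<close> of a factor \<open>w\<^sub>n\<close> commute with each other, and a letter \<open>x < y\<close> that dominates all
  of them moves to the left through \<open>w\<^sub>n\<close>. If \<open>x\<close> does not dominate the last block \<open>y i\<close>, then
  \<open>y i x = i y x\<close> replaces \<open>x\<close> by \<open>i\<close>, which does, and leaves one more block \<open>y x\<close>. The insertion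
  thus descends through the factors. It never leaves the list once the inserted letter occurs in it.
\<close>

section \<open>Congruence of words modulo the relations\<close>

text \<open>Every relation is a difference of two words, so equalities in the algebra can be derived
  by rewriting words. The first five rules are the five families of \<open>relations\<close>; the
  others close them to a congruence of the free monoid.\<close>

inductive word_cong :: "'a::linorder list \<Rightarrow> 'a list \<Rightarrow> bool"  (infix "\<approx>" 50) where
  swap_front: "i > j \<Longrightarrow> j > k \<Longrightarrow> [i, j, k] \<approx> [j, i, k]"
| swap_cycle: "i > j \<Longrightarrow> j > k \<Longrightarrow> [i, k, j] \<approx> [j, i, k]"
| swap_blocks: "i > j \<Longrightarrow> j > k \<Longrightarrow> [i, j, i, k] \<approx> [i, k, i, j]"
| swap_small: "i > j \<Longrightarrow> [i, j, j] \<approx> [j, i, j]"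
| swap_large: "i > j \<Longrightarrow> [i, i, j] \<approx> [i, j, i]"
| refl [simp, intro!]: "u \<approx> u"
| sym: "u \<approx> v \<Longrightarrow> v \<approx> u"
| trans [trans]: "u \<approx> v \<Longrightarrow> v \<approx> w \<Longrightarrow> u \<approx> w"
| append: "u \<approx> u' \<Longrightarrow> v \<approx> v' \<Longrightarrow> u @ v \<approx> u' @ v'"

lemmas append_left = word_cong.append[OF word_cong.refl]
lemmas append_right = word_cong.append[OF _ word_cong.refl]

lemma word_image_eqI:
  fixes S :: "('a, 'k::field) free_algebra set"
  assumes "word_monom u - word_monom v \<in> S"
  shows "word_image S u = word_image S v"
proof -
  let ?R = "free_ring :: ('a, 'k) free_algebra ring"
  let ?I = "Idl\<^bsub>?R\<^esub> S"
  have carrier: "carrier ?R = UNIV"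
    by (simp add: ring_of_type_algebra_def)
  interpret ideal ?I ?R by (rule ideal_Idl_free_ring)
  have "word_monom u - word_monom v \<in> ?I"
    using assms ring.genideal_self[OF ring_free_ring, of S, unfolded carrier] by blast
  \<comment> \<open>Hence \<open>word_monom u\<close> lies in the coset of
    \<open>word_monom v\<close>, and cosets that meet coincide.\<close>
  moreover have "word_monom u = (word_monom u - word_monom v) \<oplus>\<^bsub>?R\<^esub> word_monom v"
    by (simp add: ring_of_type_algebra_def)
  ultimately have "word_monom u \<in> ?I +>\<^bsub>?R\<^esub> word_monom v"
    unfolding a_r_coset_def' by blast
  then show ?thesis
    unfolding word_image_def
    by (rule a_repr_independence[symmetric]) (simp add: carrier, rule a_subgroup)
qed

lemma word_cong_imp_word_image_eq:
  assumes "u \<approx> v"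
  shows "word_image (relations :: ('a::wellorder, 'k::field) free_algebra set) u =
    word_image (relations :: ('a, 'k) free_algebra set) v"
  using assms
proof induction
  case (append u u' v v')
  then show ?case by (simp add: word_image_append)
next
  case (sym u v)
  then show ?case by simp
next
  case (trans u v w)
  then show ?case by simp
\<comment> \<open>Once products of letters are merged into single words, each swap rule is literally
  a member of one family; \<open>HOL.refl\<close> closes the reflexive case.\<close>
qed ((rule word_image_eqI,
      unfold relations_def word_monom_mult append.simps Un_iff mem_Collect_eq, blast) | rule HOL.refl)+

section \<open>Moving letters and blocks through one factor\<close>

lemma power_commute:
  assumes "p @ w \<approx> w @ p"
  shows "word_power p m @ w \<approx> w @ word_power p m"
proof (induction m)
  case 0
  then show ?case by (simp add: word_power_def)
next
  case (Suc m)
  have "p @ (word_power p m @ w) \<approx> p @ (w @ word_power p m)"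
    by (intro append_left Suc)
  also have "p @ (w @ word_power p m) \<approx> (w @ p) @ word_power p m"
    using append_right[OF assms] by simp
  finally show ?case by (simp add: word_power_def)
qed

text \<open>The exponent row \<open>t y\<close> becomes a function \<open>f\<close> of its own, so
  that the blocks can be changed apart from the trailing power of \<open>y\<close>.\<close>

definition blocks :: "('a \<Rightarrow> nat) \<Rightarrow> 'a \<Rightarrow> 'a list \<Rightarrow> 'a list" where
  "blocks f y ys = concat (map (\<lambda>z. word_power [y, z] (f z)) ys)"

lemma factor_eq_blocks: "factor t ys y = blocks (t y) y ys @ word_power [y] (t y y)"
  by (simp add: factor_def blocks_def)

lemma blocks_simps [simp]:
  "blocks f y [] = []"
  "blocks f y (z # zs) = word_power [y, z] (f z) @ blocks f y zs"
  "blocks f y (us @ vs) = blocks f y us @ blocks f y vs"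
  by (simp_all add: blocks_def)

lemma blocks_cong: "(\<And>z. z \<in> set ys \<Longrightarrow> f z = g z) \<Longrightarrow> blocks f y ys = blocks g y ys"
  unfolding blocks_def by (intro arg_cong[of _ _ concat] map_cong) auto

text \<open>Blocks with exponent 0 are empty, so commutation is asked only where \<open>f\<close> is
  nonzero, that is, on the set whose maximum is \<open>top_letter\<close>.\<close>

lemma blocks_commute:
  assumes "\<And>z. z \<in> set ys \<Longrightarrow> f z \<noteq> 0 \<Longrightarrow> [y, z] @ w \<approx> w @ [y, z]"
  shows "blocks f y ys @ w \<approx> w @ blocks f y ys"
  using assms
proof (induction ys)
  case (Cons z zs)
  have z: "word_power [y, z] (f z) @ w \<approx> w @ word_power [y, z] (f z)"
  proof (cases "f z = 0")
    case True
    then show ?thesis by (simp add: word_power_def)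
  next
    case False
    then show ?thesis using Cons.prems[of z] by (intro power_commute) simp
  qed
  have "word_power [y, z] (f z) @ (blocks f y zs @ w) \<approx> word_power [y, z] (f z) @ (w @ blocks f y zs)"
    using Cons by (intro append_left) simp
  also have "\<dots> \<approx> (w @ word_power [y, z] (f z)) @ blocks f y zs"
    using append_right[OF z] by simp
  finally show ?case by simp
qed simp

lemma blocks_commute_letter:
  assumes "x < y" and "\<And>z. z \<in> set ys \<Longrightarrow> f z \<noteq> 0 \<Longrightarrow> z \<le> x"
  shows "blocks f y ys @ [x] \<approx> x # blocks f y ys"
proof -
  have "[y, z] @ [x] \<approx> [x] @ [y, z]" if "z \<in> set ys" "f z \<noteq> 0" for z
    using assms(1) assms(2)[OF that]
    by (cases "z = x") (auto intro: swap_cycle swap_small)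
  then show ?thesis using blocks_commute[of ys f y "[x]"] by simp
qed

text \<open>By \<open>swap_blocks\<close> the appended block passes the blocks of all letters after
  \<open>x\<close> and joins the power at its own place.\<close>

lemma blocks_add_block:
  assumes "x \<in> set ys" "distinct ys" "\<forall>z \<in> set ys. z < y"
  shows "blocks f y ys @ [y, x] \<approx> blocks (f(x := f x + 1)) y ys"
proof -
  obtain us vs where ys: "ys = us @ x # vs"
    using assms(1) by (meson split_list)
  have "[y, z] @ [y, x] \<approx> [y, x] @ [y, z]" if "z \<in> set vs" for z
    using assms that ys
    by (cases z x rule: linorder_cases) (auto intro: swap_blocks word_cong.sym[OF swap_blocks])
  then have "blocks f y vs @ [y, x] \<approx> [y, x] @ blocks f y vs"
    by (intro blocks_commute)
  then have "blocks f y (us @ [x]) @ (blocks f y vs @ [y, x]) \<approx>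
      blocks f y (us @ [x]) @ ([y, x] @ blocks f y vs)"
    by (rule append_left)
  moreover have "word_power [y, x] m @ y # x # w = word_power [y, x] (Suc m) @ w" for m w
    by (induction m) (auto simp: word_power_def)
  moreover have "blocks (f(x := f x + 1)) y us = blocks f y us"
    "blocks (f(x := f x + 1)) y vs = blocks f y vs"
    using assms(2) ys by (auto intro!: blocks_cong)
  ultimately show ?thesis by (simp add: ys)
qed

text \<open>Case (b). One block \<open>[y, i]\<close> is taken to the right end, where
  \<open>swap_front\<close> turns \<open>[y, i, x]\<close> into \<open>[i, y, x]\<close>. Then
  \<open>i\<close> dominates the remaining blocks and moves to the front, while
  \<open>[y, x]\<close> joins the blocks.\<close>

lemma factor_bump_letter:
  assumes "x \<in> set ys" "i \<in> set ys" "distinct ys" "\<forall>z \<in> set ys. z < y" "x < i"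
    and "t y y = 0" "t y i \<noteq> 0" "\<And>z. z \<in> set ys \<Longrightarrow> t y z \<noteq> 0 \<Longrightarrow> z \<le> i"
  shows "factor t ys y @ [x] \<approx>
    i # factor (t(y := (t y)(i := t y i - 1, x := t y x + 1))) ys y"
proof -
  \<comment> \<open>\<open>g\<close> is the row with one block \<open>[y, i]\<close> removed; the
    old and the new row each arise from it by adding one block.\<close>
  define g where "g = (t y)(i := t y i - 1)"
  have iy: "i < y" using assms by simp
  have g: "g(i := g i + 1) = t y" "g(x := g x + 1) = (t y)(i := t y i - 1, x := t y x + 1)"
    using assms by (auto simp: g_def)
  have "blocks (t y) y ys @ [x] \<approx> (blocks g y ys @ [y, i]) @ [x]"
    using blocks_add_block[of i ys y g] assms unfolding g
    by (intro append_right) (auto intro: word_cong.sym)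
  also have "\<dots> \<approx> blocks g y ys @ [i, y, x]"
    using append_left[OF swap_front[OF iy \<open>x < i\<close>]] by simp
  also have "\<dots> \<approx> (i # blocks g y ys) @ [y, x]"
  proof -
    have "blocks g y ys @ [i] \<approx> i # blocks g y ys"
      by (intro blocks_commute_letter) (use assms iy in \<open>auto simp: g_def split: if_splits\<close>)
    from append_right[OF this, of "[y, x]"] show ?thesis by simp
  qed
  also have "\<dots> \<approx> [i] @ blocks (g(x := g x + 1)) y ys"
    using append_left[OF blocks_add_block, of x ys y "[i]" g] assms by simp
  finally show ?thesis
    using assms iy unfolding g by (auto simp: factor_eq_blocks word_power_def)
qed

text \<open>Case (c). The last \<open>y\<close> of the trailing power forms the block
  \<open>[y, x]\<close> with \<open>x\<close>, and \<open>swap_large\<close> carries this block to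
  the left of the remaining \<open>y\<close>s.\<close>

lemma factor_absorb_letter:
  assumes "x \<in> set ys" "distinct ys" "\<forall>z \<in> set ys. z < y" "t y y \<noteq> 0"
  shows "factor t ys y @ [x] \<approx>
    factor (t(y := (t y)(y := t y y - 1, x := t y x + 1))) ys y"
proof -
  obtain m where m: "t y y = Suc m" using assms(4) not0_implies_Suc by blast
  have xy: "x < y" "x \<noteq> y" using assms by auto
  have "word_power [y] m @ [y, x] \<approx> [y, x] @ word_power [y] m"
    using swap_large[OF xy(1)] by (intro power_commute) simp
  moreover have "word_power [y] (Suc m) @ [x] = word_power [y] m @ [y, x]"
    by (induction m) (auto simp: word_power_def)
  ultimately have "word_power [y] (t y y) @ [x] \<approx> [y, x] @ word_power [y] m"
    by (simp add: m)
  then have "factor t ys y @ [x] \<approx> blocks (t y) y ys @ ([y, x] @ word_power [y] m)"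
    unfolding factor_eq_blocks append_assoc by (rule append_left)
  also have "\<dots> \<approx> blocks ((t y)(x := t y x + 1)) y ys @ word_power [y] m"
    using append_right[OF blocks_add_block, of x ys y "t y"] assms by simp
  \<comment> \<open>The diagonal exponent governs only the trailing power, as \<open>y\<close> is
    not in \<open>ys\<close>.\<close>
  also have "blocks ((t y)(x := t y x + 1)) y ys =
      blocks ((t y)(y := t y y - 1, x := t y x + 1)) y ys"
    using assms by (intro blocks_cong) auto
  finally show ?thesis using xy by (simp add: factor_eq_blocks m)
qed

section \<open>Dependence of a word on its list and exponents\<close>

lemma omega_word_Nil [simp]: "omega_word [] t = []"
  by (simp add: omega_word_def)

lemma omega_word_snoc [simp]: "omega_word (ys @ [y]) t = omega_word ys t @ factor t ys y"
proof -
  have "map (\<lambda>k. factor t (take k (ys @ [y])) ((ys @ [y]) ! k)) [0..<length ys] =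
      map (\<lambda>k. factor t (take k ys) (ys ! k)) [0..<length ys]"
    by (intro map_cong) (auto simp: nth_append)
  moreover have "take (length ys) (ys @ [y]) = ys" by simp
  ultimately show ?thesis by (simp add: omega_word_def del: map_eq_conv take_append)
qed

lemma factor_cong:
  assumes "\<And>z. z \<in> insert y (set ys) \<Longrightarrow> s y z = t y z"
  shows "factor s ys y = factor t ys y"
  using blocks_cong[of ys "s y" "t y" y] assms by (simp add: factor_eq_blocks)

lemma omega_word_cong:
  assumes "\<And>y z. y \<in> set xs \<Longrightarrow> z \<in> set xs \<Longrightarrow> s y z = t y z"
  shows "omega_word xs s = omega_word xs t"
  using assms
proof (induction xs rule: rev_induct)
  case (snoc y ys)
  then show ?case using factor_cong[of y ys s t] by simp
qed simp

text \<open>Glues a shorter word and a new last factor, given by different exponents, into one word: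
  row \<open>y\<close> is read by the last factor alone.\<close>

lemma omega_word_snoc_update:
  assumes "y \<notin> set ys"
  shows "omega_word (ys @ [y]) (s(y := r y)) = omega_word ys s @ factor r ys y"
proof -
  have "omega_word ys (s(y := r y)) = omega_word ys s"
    using assms by (intro omega_word_cong) auto
  then show ?thesis using factor_cong[of y ys "s(y := r y)" r] by simp
qed

text \<open>The factor of \<open>x\<close> is empty, and so are the blocks of \<open>x\<close> in
  all later factors.\<close>

lemma omega_word_add_letter:
  assumes "x \<notin> set (us @ vs)"
  shows "omega_word (us @ x # vs) (add_letter x t) = omega_word (us @ vs) t"
  using assms
proof (induction vs rule: rev_induct)
  case Nil
  have "omega_word us (add_letter x t) = omega_word us t"
    using Nil by (intro omega_word_cong) (auto simp: add_letter_def)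
  then show ?case
    by (simp add: factor_def add_letter_def word_power_def)
next
  case (snoc v vs)
  have "factor (add_letter x t) (us @ x # vs) v = factor (add_letter x t) (us @ vs) v"
    by (simp add: factor_def add_letter_def word_power_def)
  also have "\<dots> = factor t (us @ vs) v"
    using snoc.prems by (intro factor_cong) (auto simp: add_letter_def)
  finally show ?case
    using snoc omega_word_snoc[of "us @ x # vs" v] omega_word_snoc[of "us @ vs" v] by simp
qed

lemma insort_split: "\<exists>us vs. xs = us @ vs \<and> insort x xs = us @ x # vs"
proof (induction xs)
  case (Cons a xs)
  then obtain us vs where "xs = us @ vs" "insort x xs = us @ x # vs" by blast
  then have "\<not> x \<le> a \<Longrightarrow> a # xs = (a # us) @ vs \<and> insort x (a # xs) = (a # us) @ x # vs" by simp
  moreover have "x \<le> a \<Longrightarrow> a # xs = [] @ a # xs \<and> insort x (a # xs) = [] @ x # a # xs" by simp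
  ultimately show ?case by blast
qed simp

lemma omega_word_insort:
  assumes "x \<notin> set xs"
  shows "omega_word (insort x xs) (add_letter x t) = omega_word xs t"
  using insort_split[of xs x] omega_word_add_letter[of x] assms by metis

section \<open>Insertion of a letter\<close>

lemma top_letter_eqI:
  assumes "i = top_letter xs t y x"
  shows "(\<forall>z \<in> set xs. t y z = 0) \<and> i = x \<or>
    i \<in> set xs \<and> t y i \<noteq> 0 \<and> (\<forall>z \<in> set xs. t y z \<noteq> 0 \<longrightarrow> z \<le> i)"
proof -
  define N where "N = {z \<in> set xs. t y z \<noteq> 0}"
  have i: "i = (if N = {} then x else Max N)"
    using assms unfolding top_letter_def N_def Let_def .
  have "finite N" by (simp add: N_def)
  then have "N \<noteq> {} \<Longrightarrow> Max N \<in> N \<and> (\<forall>z \<in> N. z \<le> Max N)" by simp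
  then have "N = {} \<and> i = x \<or> i \<in> N \<and> (\<forall>z \<in> N. z \<le> i)" using i by auto
  then show ?thesis unfolding N_def by blast
qed

text \<open>Keeping the list \<open>xs\<close> fixed lets the recursive result be extended by a last
  factor. The letter is arbitrary in the induction because case (b) recurses with \<open>i\<close>
  in place of \<open>x\<close>.\<close>

lemma star_in_list:
  assumes "sorted_wrt (<) xs" "x \<in> set xs"
  shows "\<exists>t'. star xs t x = omega_word xs t' \<and> omega_word xs t @ [x] \<approx> star xs t x"
  using assms
proof (induction xs arbitrary: x rule: rev_induct)
  case (snoc y ys)
  define i where "i = top_letter (ys @ [y]) t y x"
  have ys: "sorted_wrt (<) ys" "\<forall>z \<in> set ys. z < y" "y \<notin> set ys" "distinct ys"
    using snoc.prems(1) by (auto simp: sorted_wrt_append strict_sorted_iff)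
  have star: "star (ys @ [y]) t x =
      (if x = y then omega_word ys t @ factor (t(y := (t y)(y := t y y + 1))) ys y
       else if x \<ge> i then star ys t x @ factor t ys y
       else if i < y then
         star ys t i @ factor (t(y := (t y)(i := t y i - 1, x := t y x + 1))) ys y
       else omega_word ys t @ factor (t(y := (t y)(y := t y y - 1, x := t y x + 1))) ys y)"
    using snoc.prems(2) ys by (subst star.simps) (auto simp: i_def Let_def)
  note top = top_letter_eqI[OF i_def]
  have combine: "\<exists>t'. omega_word ys s @ factor r ys y = omega_word (ys @ [y]) t'" for s r
    using omega_word_snoc_update[OF ys(3)] by metis
  \<comment> \<open>Common to cases (a), with \<open>z = x\<close>, and (b), with
    \<open>z = i\<close>: once \<open>z\<close> has passed the last factor, the induction hypothesis
    inserts it into \<open>ys\<close>.\<close>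
  have descend: "\<exists>t'. star ys t z @ factor r ys y = omega_word (ys @ [y]) t' \<and>
      omega_word (ys @ [y]) t @ [x] \<approx> star ys t z @ factor r ys y"
    if z: "z \<in> set ys" and cong: "factor t ys y @ [x] \<approx> z # factor r ys y" for z r
  proof -
    obtain t' where t': "star ys t z = omega_word ys t'"
        "omega_word ys t @ [z] \<approx> star ys t z"
      using snoc.IH[OF ys(1) z] by blast
    have "omega_word (ys @ [y]) t @ [x] \<approx> (omega_word ys t @ [z]) @ factor r ys y"
      using append_left[OF cong] by simp
    also have "\<dots> \<approx> star ys t z @ factor r ys y"
      using t'(2) by (rule append_right)
    finally show ?thesis using t'(1) combine by simp
  qed
  consider "x = y" | "x \<in> set ys" "x < y" "x \<noteq> y" using snoc.prems(2) ys by auto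
  then show ?case
  proof cases
    case 1
    have "word_power [y] m @ [y] = word_power [y] (Suc m)" for m
      by (induction m) (auto simp: word_power_def)
    moreover have "blocks ((t y)(y := Suc (t y y))) y ys = blocks (t y) y ys"
      using ys by (intro blocks_cong) auto
    ultimately have "omega_word (ys @ [y]) t @ [x] = star (ys @ [y]) t x"
      unfolding star using 1 by (simp add: factor_eq_blocks)
    then show ?thesis using combine star 1 by auto
  next
    case 2
    consider "i \<le> x" | "x < i" "i < y" | "x < i" "i = y"
      using top 2 ys(2) by force
    then show ?thesis
    proof cases
      case a: 1
      have le: "z \<le> x" if "z \<in> set (ys @ [y])" "t y z \<noteq> 0" for z
        using top a that by force
      \<comment> \<open>Otherwise \<open>le\<close> would give \<open>y \<le> x\<close>. So the
        factor consists of blocks only.\<close>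
      then have "t y y = 0" using 2 by force
      then have "factor t ys y @ [x] \<approx> x # factor t ys y"
        using blocks_commute_letter[of x y ys "t y"] le 2
        by (simp add: factor_eq_blocks word_power_def)
      then show ?thesis unfolding star using descend[OF 2(1)] a 2 by simp
    next
      case b: 2
      then have i: "i \<in> set ys" "t y i \<noteq> 0" "\<forall>z \<in> set (ys @ [y]). t y z \<noteq> 0 \<longrightarrow> z \<le> i"
        using top by auto
      then have "t y y = 0" using b by force
      then have "factor t ys y @ [x] \<approx>
          i # factor (t(y := (t y)(i := t y i - 1, x := t y x + 1))) ys y"
        using b i 2 ys by (intro factor_bump_letter) auto
      then show ?thesis unfolding star using descend[OF i(1)] b 2 by auto
    next
      case c: 3
      \<comment> \<open>Since \<open>i = y\<close> differs from \<open>x\<close>, it is not the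
        default value of \<open>top_letter\<close>.\<close>
      then have "t y y \<noteq> 0" using top by auto
      then have "factor t ys y @ [x] \<approx>
          factor (t(y := (t y)(y := t y y - 1, x := t y x + 1))) ys y"
        using 2 ys by (intro factor_absorb_letter) auto
      from append_left[OF this] show ?thesis unfolding star using combine c 2 by auto
    qed
  qed
qed simp

lemma star_in_Omega_and_cong:
  assumes "sorted_wrt (<) xs"
  shows "star xs t x \<in> Omega \<and> omega_word xs t @ [x] \<approx> star xs t x"
proof -
  \<comment> \<open>The empty list falls under the second case; the third joins a new letter inside
    the range with one below all others.\<close>
  consider "x \<in> set xs" | "x \<notin> set xs" "\<forall>z \<in> set xs. z < x"
    | "x \<notin> set xs" "xs \<noteq> []" "x < last xs"
  proof (cases xs rule: rev_cases)
    case (snoc ys y)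
    then show ?thesis
      using that assms by (cases x y rule: linorder_cases) (force simp: sorted_wrt_append)+
  qed (use that in simp)
  then show ?thesis
  proof cases
    case 1
    then show ?thesis using star_in_list[OF assms] assms unfolding Omega_def by blast
  next
    case 2
    \<comment> \<open>With this row the factor of the new last letter is just
      \<open>[x]\<close>.\<close>
    define r where "r = (\<lambda>y z. if y = x \<and> z = x then 1 else 0 :: nat)"
    have "blocks (r x) x xs = blocks (\<lambda>_. 0) x xs"
      using 2 by (intro blocks_cong) (auto simp: r_def)
    also have "\<dots> = []" by (induction xs) (auto simp: word_power_def)
    finally have "omega_word (xs @ [x]) (t(x := r x)) = omega_word xs t @ [x]"
      using omega_word_snoc_update[OF 2(1), of t r]
      by (simp add: factor_eq_blocks word_power_def r_def)
    moreover have "sorted_wrt (<) (xs @ [x])"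
      using assms 2 by (simp add: sorted_wrt_append)
    ultimately have "omega_word xs t @ [x] \<in> Omega"
      unfolding Omega_def by (smt (verit) mem_Collect_eq)
    moreover have "star xs t x = omega_word xs t @ [x]"
      using 2 by (subst star.simps) (auto simp: Let_def)
    ultimately show ?thesis by simp
  next
    case 3
    have sorted: "sorted_wrt (<) (insort x xs)"
      using assms 3 by (simp add: strict_sorted_iff sorted_insort distinct_insort)
    \<comment> \<open>The word is unchanged by the added letter, which now occurs in the list, so
      \<open>star_in_list\<close> applies.\<close>
    have "star xs t x = star (insort x xs) (add_letter x t) x"
      using 3 by (subst star.simps) (auto simp: Let_def)
    then show ?thesis
      using star_in_list[OF sorted, of x "add_letter x t"] omega_word_insort[OF 3(1), of t] sorted
      unfolding Omega_def by (auto simp: set_insort_key)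
  qed
qed

theorem lemma2p2:
  fixes xs :: "'a::wellorder list" and t :: "'a \<Rightarrow> 'a \<Rightarrow> nat" and x :: 'a
  assumes "sorted_wrt (<) xs"
  shows "star xs t x \<in> Omega \<and>
    word_image (relations :: ('a, 'k::field) free_algebra set) (omega_word xs t @ [x]) =
    word_image (relations :: ('a, 'k) free_algebra set) (star xs t x)"
  using star_in_Omega_and_cong[OF assms] word_cong_imp_word_image_eq by blast

end
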